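(* Let $(X,\mathscr{O},\mathscr{B})$ be a topological measurable space such that the topological space $(X,\mathscr{O})$ is first-countable and realcompact. Then there is no free ultrafilter in $\mathscr{B}$ with the countable intersection property.
   Context: A topological measurable space is a triple $(X,\mathscr{O},\mathscr{B})$ where $(X,\mathscr{B})$ is a measurable space (i.e. $\mathscr{B}$ is a $\sigma$-algebra on $X$) and $(X,\mathscr{O})$ is a topological space such that $\mathscr{O}\subseteq\mathscr{B}$, i.e. every open set is measurable. A topological space is realcompact if it is homeomorphic to a closed subspace of some topological product of copies of the real line. For a measurable space $(X,\mathscr{B})$: a non-empty $\mathscr{A}\subseteq\mathscr{B}$ is a filter-base in $\mathscr{B}$ if for every $A,B\in\mathscr{A}$ there is a non-empty $C\in\mathscr{A}$ with $C\subseteq A\cap B$. A filter $\mathscr{F}$ in $\mathscr{B}$ is a filter-base such that $B\in\mathscr{F}$ whenever $B\in\mathscr{B}$ and $F\subseteq B$ for some $F\in\mathscr{F}$. An ultrafilter in $\mathscr{B}$ is a maximal (with respect to $\subseteq$) filter in $\mathscr{B}$. An ultrafilter is free if the intersection of all its elements is empty. It has the countable intersection property if every countable collection of its elements has non-empty intersection. *)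

theory Defs
  imports "HOL-Analysis.Analysis"
begin

definition topological_measurable_space :: "'a topology \<Rightarrow> 'a set set \<Rightarrow> bool" where
  "topological_measurable_space X \<B> \<longleftrightarrow>
     sigma_algebra (topspace X) \<B> \<and> {U. openin X U} \<subseteq> \<B>"

text \<open>HOL cannot quantify existentially over types, so the type from which the index set
  of the power of the real line is drawn is a parameter.  A theorem assuming
  \<open>realcompact_space TYPE('i) X\<close> with a free type variable \<open>'i\<close> covers index sets of
  every size.\<close>

definition realcompact_space :: "'i itself \<Rightarrow> 'a topology \<Rightarrow> bool" where
  "realcompact_space _ X \<longleftrightarrow>
     (\<exists>(I :: 'i set) S. closedin (product_topology (\<lambda>_. euclideanreal) I) S \<and>
        X homeomorphic_space subtopology (product_topology (\<lambda>_. euclideanreal) I) S)"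

text \<open>Taking \<open>A = B\<close> below shows that all members of a filter-base are non-empty.\<close>

definition filter_base_in :: "'a set set \<Rightarrow> 'a set set \<Rightarrow> bool" where
  "filter_base_in \<B> \<A> \<longleftrightarrow> \<A> \<noteq> {} \<and> \<A> \<subseteq> \<B> \<and>
     (\<forall>A\<in>\<A>. \<forall>B\<in>\<A>. \<exists>C\<in>\<A>. C \<noteq> {} \<and> C \<subseteq> A \<inter> B)"

definition filter_in :: "'a set set \<Rightarrow> 'a set set \<Rightarrow> bool" where
  "filter_in \<B> \<F> \<longleftrightarrow> filter_base_in \<B> \<F> \<and>
     (\<forall>B\<in>\<B>. \<forall>F\<in>\<F>. F \<subseteq> B \<longrightarrow> B \<in> \<F>)"

definition ultrafilter_in :: "'a set set \<Rightarrow> 'a set set \<Rightarrow> bool" where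
  "ultrafilter_in \<B> \<F> \<longleftrightarrow> filter_in \<B> \<F> \<and>
     (\<forall>\<G>. filter_in \<B> \<G> \<and> \<F> \<subseteq> \<G> \<longrightarrow> \<G> = \<F>)"

definition free_family :: "'a set set \<Rightarrow> bool" where
  "free_family \<F> \<longleftrightarrow> \<Inter>\<F> = {}"

definition countable_intersection_property :: "'a set set \<Rightarrow> bool" where
  "countable_intersection_property \<F> \<longleftrightarrow>
     (\<forall>\<C>. \<C> \<subseteq> \<F> \<and> \<C> \<noteq> {} \<and> countable \<C> \<longrightarrow> \<Inter>\<C> \<noteq> {})"

end

(* By the Lindelof property of the real line, a countably intersecting
   ultrafilter pushed forward along any continuous real function converges to a real number.
   Coordinatewise limits give a limit in the power of the real line, which lies in the image of X
   because that image is closed; hence the ultrafilter contains every open neighbourhood of some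
   point p of X.  Countably many of these neighbourhoods intersect in {p} alone, so the countable
   intersection property puts p into every member of the ultrafilter. *)
theory Submission
  imports Defs
begin

section \<open>Filters and ultrafilters in a sigma-algebra\<close>

lemma filter_in_superset:
  assumes "filter_in \<B> \<F>" "A \<in> \<F>" "A \<subseteq> B" "B \<in> \<B>"
  shows "B \<in> \<F>"
  using assms unfolding filter_in_def by blast

lemma filter_in_subset:
  assumes "filter_in \<B> \<F>"
  shows "\<F> \<subseteq> \<B>"
  using assms unfolding filter_in_def filter_base_in_def by blast

text \<open>If every member of \<open>\<F>\<close> met \<open>B\<close>, the traces
  \<open>A \<inter> B\<close> would generate a filter containing both \<open>\<F>\<close> and
  \<open>B\<close>, and maximality would force \<open>B \<in> \<F>\<close>. So some member misses
  \<open>B\<close> and lies in the complement.\<close>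

lemma ultrafilter_in_compl:
  assumes \<F>: "ultrafilter_in \<B> \<F>" and \<B>: "sigma_algebra \<Omega> \<B>"
    and B: "B \<in> \<B>" "B \<notin> \<F>"
  shows "\<Omega> - B \<in> \<F>"
proof -
  interpret sigma_algebra \<Omega> \<B> by (fact \<B>)
  have filter: "filter_in \<B> \<F>"
    and maximal: "\<And>\<G>. filter_in \<B> \<G> \<Longrightarrow> \<F> \<subseteq> \<G> \<Longrightarrow> \<G> = \<F>"
    using \<F> unfolding ultrafilter_in_def by auto
  have sub: "\<F> \<subseteq> \<B>" and ne: "\<F> \<noteq> {}"
    and base: "\<And>A B. A \<in> \<F> \<Longrightarrow> B \<in> \<F> \<Longrightarrow> \<exists>C\<in>\<F>. C \<noteq> {} \<and> C \<subseteq> A \<inter> B"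
    using filter unfolding filter_in_def filter_base_in_def by blast+
  \<comment> \<open>The upward closure in \<open>\<B>\<close> of the traces on \<open>B\<close>; it
    is a filter exactly because no trace is empty.\<close>
  define \<G> where "\<G> = {C \<in> \<B>. \<exists>A\<in>\<F>. A \<inter> B \<subseteq> C}"
  have "\<exists>A\<in>\<F>. A \<inter> B = {}"
  proof (rule ccontr)
    assume "\<not> ?thesis"
    then have meets: "\<And>A. A \<in> \<F> \<Longrightarrow> A \<inter> B \<noteq> {}"
      by blast
    have "filter_in \<B> \<G>"
      unfolding filter_in_def filter_base_in_def
    proof (intro conjI ballI impI)
      show "\<G> \<noteq> {}" "\<G> \<subseteq> \<B>"
        using ne B sub unfolding \<G>_def by blast+
      show "\<exists>C\<in>\<G>. C \<noteq> {} \<and> C \<subseteq> D \<inter> E" if DE: "D \<in> \<G>" "E \<in> \<G>" for D E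
      proof -
        obtain A where A: "A \<in> \<F>" "A \<inter> B \<subseteq> D"
          using DE(1) unfolding \<G>_def by auto
        obtain A' where A': "A' \<in> \<F>" "A' \<inter> B \<subseteq> E"
          using DE(2) unfolding \<G>_def by auto
        obtain C where C: "C \<in> \<F>" "C \<subseteq> A \<inter> A'"
          using base[OF A(1) A'(1)] by auto
        have "C \<inter> B \<in> \<G>"
          using C(1) sub B(1) unfolding \<G>_def by auto
        moreover have "C \<inter> B \<subseteq> D \<inter> E"
          using A(2) A'(2) C(2) by auto
        ultimately show ?thesis
          using meets[OF C(1)] by (intro bexI[of _ "C \<inter> B"] conjI)
      qed
      show "D \<in> \<G>" if "D \<in> \<B>" "C \<in> \<G>" "C \<subseteq> D" for C D
        using that unfolding \<G>_def by blast
    qed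
    moreover have "\<F> \<subseteq> \<G>" "B \<in> \<G>"
      using sub ne B unfolding \<G>_def by blast+
    ultimately show False
      using maximal B by blast
  qed
  then obtain A where "A \<in> \<F>" "A \<inter> B = {}" ..
  moreover from this have "A \<subseteq> \<Omega> - B"
    using sub sets_into_space by blast
  ultimately show ?thesis
    using filter_in_superset[OF filter] B by blast
qed

lemma countable_intersection_property_witness:
  assumes "countable_intersection_property \<F>" "\<C> \<subseteq> \<F>" "\<C> \<noteq> {}" "countable \<C>"
  shows "\<exists>x. \<forall>C\<in>\<C>. x \<in> C"
proof -
  have "\<Inter>\<C> \<noteq> {}"
    using assms unfolding countable_intersection_property_def by simp
  then show ?thesis
    by auto
qed

section \<open>Limits of a fixed countably intersecting ultrafilter\<close>

context
  fixes X :: "'a topology" and \<B> \<F> :: "'a set set"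
  assumes tms: "topological_measurable_space X \<B>"
    and ultrafilter: "ultrafilter_in \<B> \<F>"
    and cip: "countable_intersection_property \<F>"
begin

lemma members_subset_topspace:
  assumes "A \<in> \<F>"
  shows "A \<subseteq> topspace X"
proof -
  interpret sigma_algebra "topspace X" \<B>
    using tms unfolding topological_measurable_space_def by simp
  show ?thesis
    using assms ultrafilter sets_into_space filter_in_subset
    unfolding ultrafilter_in_def by blast
qed

lemma compl_of_open_nonmember:
  assumes "openin X U" "U \<notin> \<F>"
  shows "topspace X - U \<in> \<F>"
  using assms tms by (intro ultrafilter_in_compl[OF ultrafilter])
    (auto simp: topological_measurable_space_def)

text \<open>Without a limit, the open sets whose preimages are not in \<open>\<F>\<close> would
  cover the codomain. By Lindelof countably many of them suffice, and the complements of their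
  preimages are countably many members of \<open>\<F>\<close> with no common point.\<close>

lemma limit_of_continuous_map:
  fixes g :: "'a \<Rightarrow> 'b::second_countable_topology"
  assumes g: "continuous_map X euclidean g"
  obtains r where "\<And>U. open U \<Longrightarrow> r \<in> U \<Longrightarrow> {x \<in> topspace X. g x \<in> U} \<in> \<F>"
proof (rule ccontr)
  define \<U> where "\<U> = {U. open U \<and> {x \<in> topspace X. g x \<in> U} \<notin> \<F>}"
  assume "\<not> thesis"
  then have "\<exists>U. open U \<and> r \<in> U \<and> {x \<in> topspace X. g x \<in> U} \<notin> \<F>" for r
    using that[of r] by auto
  then have cover: "\<Union>\<U> = UNIV"
    unfolding \<U>_def by auto
  have "\<And>U. U \<in> \<U> \<Longrightarrow> open U"
    unfolding \<U>_def by simp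
  then obtain \<V> where \<V>: "\<V> \<subseteq> \<U>" "countable \<V>" "\<Union>\<V> = \<Union>\<U>"
    by (rule Lindelof)
  define \<C> where "\<C> = (\<lambda>U. topspace X - {x \<in> topspace X. g x \<in> U}) ` \<V>"
  have \<C>: "\<C> \<subseteq> \<F>"
  proof -
    have "topspace X - {x \<in> topspace X. g x \<in> U} \<in> \<F>" if "U \<in> \<V>" for U
    proof (rule compl_of_open_nonmember)
      show "openin X {x \<in> topspace X. g x \<in> U}"
        using that \<V>(1) by (intro openin_continuous_map_preimage[OF g]) (auto simp: \<U>_def)
      show "{x \<in> topspace X. g x \<in> U} \<notin> \<F>"
        using that \<V>(1) by (auto simp: \<U>_def)
    qed
    then show ?thesis
      unfolding \<C>_def by blast
  qed
  \<comment> \<open>The countable intersection property speaks of non-empty families only.\<close>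
  have "\<V> \<noteq> {}"
    using \<V>(3) unfolding cover by auto
  then have "\<C> \<noteq> {}" "countable \<C>"
    using \<V>(2) unfolding \<C>_def by auto
  then obtain x where x: "\<And>C. C \<in> \<C> \<Longrightarrow> x \<in> C"
    using countable_intersection_property_witness[OF cip \<C>] by auto
  have "g x \<in> \<Union>\<V>"
    unfolding \<V>(3) cover by simp
  then obtain U where "U \<in> \<V>" "g x \<in> U" ..
  then show False
    using x unfolding \<C>_def by blast
qed

text \<open>The limit is taken coordinatewise. A basic box around it constrains finitely many
  coordinates, so countable intersections suffice whatever the size of \<open>I\<close>.\<close>

lemma limit_of_map_into_power:
  fixes h :: "'a \<Rightarrow> 'i \<Rightarrow> 'b::second_countable_topology"
  assumes h: "continuous_map X (product_topology (\<lambda>_. euclidean) I) h"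
  obtains r where "r \<in> extensional I"
    and "\<And>T. openin (product_topology (\<lambda>_. euclidean) I) T \<Longrightarrow> r \<in> T \<Longrightarrow>
           {x \<in> topspace X. h x \<in> T} \<in> \<F>"
proof -
  have "\<exists>r. \<forall>U. open U \<longrightarrow> r \<in> U \<longrightarrow> {x \<in> topspace X. h x i \<in> U} \<in> \<F>" if "i \<in> I" for i
  proof -
    have "continuous_map X euclidean (\<lambda>x. h x i)"
      using h that unfolding continuous_map_componentwise by auto
    then show ?thesis
      by (rule limit_of_continuous_map) auto
  qed
  then obtain s where
    s: "\<And>i U. i \<in> I \<Longrightarrow> open U \<Longrightarrow> s i \<in> U \<Longrightarrow> {x \<in> topspace X. h x i \<in> U} \<in> \<F>"
    by metis
  \<comment> \<open>Points of the product take the value \<open>undefined\<close> off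
    \<open>I\<close>, hence the restriction.\<close>
  define r where "r = restrict s I"
  have "{x \<in> topspace X. h x \<in> T} \<in> \<F>"
    if T: "openin (product_topology (\<lambda>_. euclidean) I) T" "r \<in> T" for T
  proof (rule ccontr)
    assume "{x \<in> topspace X. h x \<in> T} \<notin> \<F>"
    then have compl: "topspace X - {x \<in> topspace X. h x \<in> T} \<in> \<F>"
      using compl_of_open_nonmember openin_continuous_map_preimage[OF h T(1)] by blast
    have "\<exists>U. finite {i \<in> I. U i \<noteq> UNIV} \<and> (\<forall>i\<in>I. open (U i)) \<and>
      r \<in> Pi\<^sub>E I U \<and> Pi\<^sub>E I U \<subseteq> T"
      using T by (simp add: openin_product_topology_alt flip: open_openin)
    then obtain U where U: "finite {i \<in> I. U i \<noteq> UNIV}" "\<And>i. i \<in> I \<Longrightarrow> open (U i)"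
      "r \<in> Pi\<^sub>E I U" "Pi\<^sub>E I U \<subseteq> T"
      by auto
    \<comment> \<open>A common point of this finite family would be mapped by \<open>h\<close> into
      the box, hence into \<open>T\<close>, while lying outside the preimage of
      \<open>T\<close>.\<close>
    define \<C> where "\<C> = insert (topspace X - {x \<in> topspace X. h x \<in> T})
      ((\<lambda>i. {x \<in> topspace X. h x i \<in> U i}) ` {i \<in> I. U i \<noteq> UNIV})"
    have "{x \<in> topspace X. h x i \<in> U i} \<in> \<F>" if "i \<in> I" for i
    proof (rule s)
      show "s i \<in> U i"
        using U(3) that unfolding r_def by (auto simp: PiE_iff)
    qed (use U that in auto)
    then have "\<C> \<subseteq> \<F>" "\<C> \<noteq> {}" "countable \<C>"
      using compl U(1) unfolding \<C>_def by (auto intro: countable_finite)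
    then obtain x where x: "\<And>C. C \<in> \<C> \<Longrightarrow> x \<in> C"
      using countable_intersection_property_witness[OF cip] by meson
    have out: "x \<in> topspace X" "h x \<notin> T"
      using x unfolding \<C>_def by auto
    have "h x \<in> extensional I"
      using continuous_map_image_subset_topspace[OF h] out(1)
      by (auto simp: topspace_product_topology PiE_def)
    \<comment> \<open>Coordinates left out of \<open>\<C>\<close> carry the factor
      \<open>UNIV\<close> and impose no condition.\<close>
    moreover have "h x i \<in> U i" if "i \<in> I" for i
      using x that unfolding \<C>_def by (cases "U i = UNIV") auto
    ultimately have "h x \<in> Pi\<^sub>E I U"
      by (simp add: PiE_iff)
    then show False
      using U(4) out(2) by blast
  qed
  then show thesis
    using that[of r] unfolding r_def by simp
qed

text \<open>A closed embedding into the power reflects convergence: the limit of the embedded points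
  stays in the image, and neighbourhoods of its preimage \<open>p\<close> are preimages of
  neighbourhoods of the limit.\<close>

lemma converges_if_realcompact:
  assumes "realcompact_space TYPE('i) X"
  obtains p where "p \<in> topspace X" and "\<And>U. openin X U \<Longrightarrow> p \<in> U \<Longrightarrow> U \<in> \<F>"
proof -
  obtain I :: "'i set" and S where
    S: "closedin (product_topology (\<lambda>_. euclideanreal) I) S"
    and homeo: "X homeomorphic_space subtopology (product_topology (\<lambda>_. euclideanreal) I) S"
    using assms unfolding realcompact_space_def by blast
  define P where "P = product_topology (\<lambda>_::'i. euclideanreal) I"
  obtain h where h: "homeomorphic_map X (subtopology P S) h"
    using homeo unfolding homeomorphic_space P_def by blast
  have S: "closedin P S"
    using S unfolding P_def .
  then have image: "h ` topspace X = S"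
    using homeomorphic_imp_surjective_map[OF h] closedin_subset[OF S]
    by (simp add: topspace_subtopology Int_absorb1)
  have "continuous_map X P h"
    using homeomorphic_imp_continuous_map[OF h] continuous_map_in_subtopology by blast
  then obtain r where "r \<in> extensional I"
    and r: "\<And>T. openin P T \<Longrightarrow> r \<in> T \<Longrightarrow> {x \<in> topspace X. h x \<in> T} \<in> \<F>"
    unfolding P_def by (rule limit_of_map_into_power) blast
  have "r \<in> S"
  \<comment> \<open>As \<open>S\<close> is closed, its complement would be an open neighbourhood of
    \<open>r\<close>; but its preimage under \<open>h\<close> is empty.\<close>
  proof (rule ccontr)
    assume "r \<notin> S"
    then have "r \<in> topspace P - S"
      using \<open>r \<in> extensional I\<close> unfolding P_def by (simp add: PiE_iff)
    then have "{x \<in> topspace X. h x \<in> topspace P - S} \<in> \<F>"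
      by (intro r openin_diff[OF openin_topspace S])
    moreover have "{x \<in> topspace X. h x \<in> topspace P - S} = {}"
      using image by blast
    ultimately have "{} \<in> \<F>"
      by metis
    then show False
      using countable_intersection_property_witness[OF cip, of "{{}}"] by simp
  qed
  then obtain p where p: "p \<in> topspace X" "h p = r"
    using image by blast
  have "U \<in> \<F>" if U: "openin X U" "p \<in> U" for U
  proof -
    have sub: "U \<subseteq> topspace X"
      using U openin_subset by blast
    have "openin (subtopology P S) (h ` U)"
      using homeomorphic_map_openness[OF h sub] U by blast
    then obtain T where T: "openin P T" "h ` U = T \<inter> S"
      unfolding openin_subtopology by blast
    have "{x \<in> topspace X. h x \<in> T} = U"
    proof (intro equalityI subsetI)
      fix x assume x: "x \<in> {x \<in> topspace X. h x \<in> T}"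
      then have "h x \<in> h ` U"
        using T(2) image by auto
      then show "x \<in> U"
        using x sub inj_on_image_mem_iff[OF homeomorphic_imp_injective_map[OF h]] by simp
    next
      fix x assume "x \<in> U"
      then show "x \<in> {x \<in> topspace X. h x \<in> T}"
        using T(2) sub by auto
    qed
    moreover have "r \<in> T"
      using T p U by blast
    ultimately show ?thesis
      using r T by metis
  qed
  then show thesis
    using that p by blast
qed

text \<open>A countable local base at \<open>p\<close> together with \<open>A\<close> has a common
  point. It lies in every neighbourhood of \<open>p\<close>, so by the T1 axiom it is
  \<open>p\<close> itself.\<close>

lemma limit_in_every_member:
  assumes "first_countable X" "t1_space X"
    and p: "p \<in> topspace X" "\<And>U. openin X U \<Longrightarrow> p \<in> U \<Longrightarrow> U \<in> \<F>"
    and A: "A \<in> \<F>"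
  shows "p \<in> A"
proof -
  obtain \<V> where \<V>: "countable \<V>" "\<And>V. V \<in> \<V> \<Longrightarrow> openin X V"
    "\<And>U. openin X U \<Longrightarrow> p \<in> U \<Longrightarrow> \<exists>V\<in>\<V>. p \<in> V \<and> V \<subseteq> U"
    using assms(1) p(1) unfolding first_countable_def by metis
  \<comment> \<open>\<open>\<V>\<close> may contain open sets that miss \<open>p\<close>; membership
    in \<open>\<F>\<close> is known only for the neighbourhoods of \<open>p\<close>.\<close>
  have "insert A {V \<in> \<V>. p \<in> V} \<subseteq> \<F>" "countable (insert A {V \<in> \<V>. p \<in> V})"
    using A p(2) \<V> by auto
  then obtain x where x: "\<And>C. C \<in> insert A {V \<in> \<V>. p \<in> V} \<Longrightarrow> x \<in> C"
    using countable_intersection_property_witness[OF cip, of "insert A {V \<in> \<V>. p \<in> V}"]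
    by blast
  have "x = p"
  proof (rule ccontr)
    assume "x \<noteq> p"
    moreover have "x \<in> topspace X"
      using x A members_subset_topspace by blast
    ultimately obtain U where "openin X U" "p \<in> U" "x \<notin> U"
      using assms(2) p(1) unfolding t1_space_def by metis
    then show False
      using \<V>(3) x by blast
  qed
  then show ?thesis
    using x by blast
qed

end

section \<open>Separation and the contradiction with freeness\<close>

text \<open>Powers of the real line are Hausdorff, and this passes to subspaces and homeomorphic
  copies. It supplies the T1 axiom that identifies the limit point.\<close>

lemma realcompact_imp_Hausdorff_space:
  assumes "realcompact_space TYPE('i) X"
  shows "Hausdorff_space X"
proof -
  obtain I :: "'i set" and S where
    "X homeomorphic_space subtopology (product_topology (\<lambda>_. euclideanreal) I) S"
    using assms unfolding realcompact_space_def by blast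
  moreover have "Hausdorff_space (subtopology (product_topology (\<lambda>_. euclideanreal) I) S)"
    by (intro Hausdorff_space_subtopology)
      (simp add: Hausdorff_space_product_topology)
  ultimately show ?thesis
    using homeomorphic_Hausdorff_space by blast
qed

theorem theorem4p7:
  fixes X :: "'a topology" and \<B> :: "'a set set"
  assumes "topological_measurable_space X \<B>"
    and "first_countable X"
    and "realcompact_space TYPE('i) X"
  shows "\<not> (\<exists>\<F>. ultrafilter_in \<B> \<F> \<and> free_family \<F> \<and> countable_intersection_property \<F>)"
proof
  assume "\<exists>\<F>. ultrafilter_in \<B> \<F> \<and> free_family \<F> \<and> countable_intersection_property \<F>"
  then obtain \<F> where \<F>: "ultrafilter_in \<B> \<F>" "countable_intersection_property \<F>"
    and free: "\<Inter>\<F> = {}"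
    unfolding free_family_def by blast
  have "t1_space X"
    using assms(3) realcompact_imp_Hausdorff_space Hausdorff_imp_t1_space by blast
  obtain p where "p \<in> topspace X" "\<And>U. openin X U \<Longrightarrow> p \<in> U \<Longrightarrow> U \<in> \<F>"
    using converges_if_realcompact[OF assms(1) \<F> assms(3)] by blast
  then have "p \<in> \<Inter>\<F>"
    using limit_in_every_member[OF assms(1) \<F> assms(2) \<open>t1_space X\<close>] by blast
  then show False
    using free by blast
qed

end
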